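(* Let $N,m\ge 1$. Almost all spline functions $f = \sum_{j=1}^{N} c_j^{(m)} B_{j,m}$ of order $m$ with coefficients $c_j^{(m)}\in\mathbb{C}$ and real knots $T_1<\dots<T_{N+m}$ can be uniquely recovered from their Fourier intensities $|\widehat f|$ up to trivial ambiguities. That is, for all parameters $(c_1^{(m)},\dots,c_N^{(m)},T_1,\dots,T_{N+m}) \in \mathbb{C}^N\times\mathbb{R}^{N+m}\cong\mathbb{R}^{3N+m}$ with $T_1<\dots<T_{N+m}$ outside a set of Lebesgue measure zero, the corresponding spline $f$ has the following property: every spline function $g$ of order $m$ of the same form (with the same $N$ and $m$, but its own complex coefficients and strictly increasing real knots) with $|\widehat g(\omega)| = |\widehat f(\omega)|$ for all $\omega\in\mathbb{R}$ coincides with $f$ up to trivial ambiguities.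
   Context: B-splines: for knots $T_1<\dots<T_{N+m}$, put $B_{j,1} = \mathbf 1_{[T_j,T_{j+1})}$ and recursively, for order $r\ge 2$, $$B_{j,r}(t) = \frac{t-T_j}{T_{j+r-1}-T_j} B_{j,r-1}(t) + \frac{T_{j+r}-t}{T_{j+r}-T_{j+1}} B_{j+1,r-1}(t).$$ The Fourier transform is $\widehat f(\omega) = \int_{-\infty}^{\infty} f(t) e^{-\mathrm{i}\omega t}\,dt$, $\omega\in\mathbb{R}$. Trivial ambiguities: rotation $f \mapsto e^{\mathrm{i}\alpha} f$ ($\alpha\in\mathbb{R}$), time shift $f \mapsto f(\cdot - t_0)$ ($t_0 \in \mathbb{R}$), conjugation and reflection $f \mapsto \overline{f(-\cdot)}$, and combinations of these. Two signals coincide up to trivial ambiguities if one is obtained from the other by such a combination, i.e. $g = e^{\mathrm{i}\alpha} f(\cdot - t_0)$ or $g = e^{\mathrm{i}\alpha}\, \overline{f(t_0-\cdot)}$ for some $\alpha,t_0\in\mathbb{R}$, with equality understood almost everywhere. *)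

theory Defs
  imports "HOL-Analysis.Analysis"
begin

text \<open>The B-spline \<open>B\<^sub>j\<^sub>,\<^sub>r\<close> with respect to the knots \<open>T\<close>. Orders start at 1; the clause for
  \<open>r = 0\<close> is a dummy value that the recursion never reaches from \<open>r \<ge> 1\<close>. Only the knots
  \<open>T j, \<dots>, T (j + r)\<close> enter.\<close>

fun bspline :: "(nat \<Rightarrow> real) \<Rightarrow> nat \<Rightarrow> nat \<Rightarrow> real \<Rightarrow> real" where
  "bspline T j 0 t = 0"
| "bspline T j (Suc 0) t = indicator {T j..<T (j + 1)} t"
| "bspline T j (Suc (Suc k)) t =
     (let r = Suc (Suc k) in
       (t - T j) / (T (j + r - 1) - T j) * bspline T j (Suc k) t
     + (T (j + r) - t) / (T (j + r) - T (j + 1)) * bspline T (j + 1) (Suc k) t)"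

definition spline :: "nat \<Rightarrow> nat \<Rightarrow> (nat \<Rightarrow> complex) \<Rightarrow> (nat \<Rightarrow> real) \<Rightarrow> real \<Rightarrow> complex" where
  "spline N m c T t = (\<Sum>j=1..N. c j * complex_of_real (bspline T j m t))"

definition fourier_transform :: "(real \<Rightarrow> complex) \<Rightarrow> real \<Rightarrow> complex" where
  "fourier_transform f \<omega> = (LINT t|lborel. f t * exp (- \<i> * complex_of_real (\<omega> * t)))"

definition trivially_equivalent :: "(real \<Rightarrow> complex) \<Rightarrow> (real \<Rightarrow> complex) \<Rightarrow> bool" where
  "trivially_equivalent f g \<longleftrightarrow>
     (\<exists>\<alpha> t0. (AE t in lborel. g t = exp (\<i> * complex_of_real \<alpha>) * f (t - t0))
           \<or> (AE t in lborel. g t = exp (\<i> * complex_of_real \<alpha>) * cnj (f (t0 - t))))"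

text \<open>Lebesgue measure on \<open>\<complex>\<^sup>N \<times> \<real>\<^sup>N\<^sup>+\<^sup>m \<cong> \<real>\<^sup>3\<^sup>N\<^sup>+\<^sup>m\<close>, vectors being functions on \<open>{1..N}\<close> and
  \<open>{1..N + m}\<close>. This is the measure on the Borel sets rather than its completion; the almost
  everywhere quantifier is the same for both, as it only asks that the exceptional set
  be contained in a measurable null set.\<close>

definition spline_params :: "nat \<Rightarrow> nat \<Rightarrow> ((nat \<Rightarrow> complex) \<times> (nat \<Rightarrow> real)) measure" where
  "spline_params N m = Pi\<^sub>M {1..N} (\<lambda>_. lborel) \<Otimes>\<^sub>M Pi\<^sub>M {1..N + m} (\<lambda>_. lborel)"

end

theory Submission imports Defs "HOL-Library.Multiset" begin

text \<open>Writing B-splines as divided differences of truncated powers turns a spline of order \<open>m\<close> into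
  \<open>f t = (\<Sum>j. a j * (T j - t)\<^sub>+ ^ (m - 1))\<close>, where the \<open>a j\<close> annihilate polynomials of degree
  less than \<open>m\<close>. Hence \<open>(- \<i> \<omega>) ^ m\<close> times the Fourier transform of \<open>f\<close> is \<open>(m - 1)!\<close> times the
  exponential sum of the \<open>a j\<close> at the knots, and the intensity determines the autocorrelation of
  the discrete measure with masses \<open>a j\<close> at \<open>T j\<close>. Generically the knots are linearly independent
  over the integers and no \<open>a j\<close> vanishes. Then the knot differences of a competitor \<open>g\<close> must be
  exactly those of \<open>f\<close>. By independence, the differences of its knots from a fixed one all have
  the form \<open>T p - T q\<close> with a common \<open>q\<close> or with a common \<open>p\<close>, so the knots of \<open>g\<close> are a translate
  or a reflection of those of \<open>f\<close>. The off-diagonal products \<open>a j * cnj (a k)\<close> are then known, and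
  the diagonal ones follow from \<open>(\<Sum>j. a j) = 0\<close>; so the coefficients agree up to a phase.\<close>

subsection \<open>B-splines and truncated powers\<close>

text \<open>The coefficient of \<open>h (T i)\<close> in the divided difference of \<open>h\<close>
  at the nodes indexed by \<open>K\<close>.\<close>

definition lagrange_weight :: "('i \<Rightarrow> 'a::field) \<Rightarrow> 'i set \<Rightarrow> 'i \<Rightarrow> 'a" where
  "lagrange_weight T K i = inverse (\<Prod>k\<in>K - {i}. T i - T k)"

lemma lagrange_weight_remove:
  assumes "finite K" "b \<in> K" "i \<in> K" "i \<noteq> b" "T i \<noteq> T b"
  shows "lagrange_weight T (K - {b}) i = lagrange_weight T K i * (T i - T b)"
proof -
  have "K - {i} = insert b (K - {b} - {i})" using assms by auto
  moreover have "finite (K - {b} - {i})" "b \<notin> K - {b} - {i}" using assms by auto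
  ultimately have *: "(\<Prod>k\<in>K - {i}. T i - T k) = (T i - T b) * (\<Prod>k\<in>K - {b} - {i}. T i - T k)"
    by (metis (no_types, lifting) prod.insert)
  show ?thesis using assms by (simp add: lagrange_weight_def *)
qed

lemma lagrange_weight_nonzero:
  assumes "finite K" "inj_on T K" "i \<in> K"
  shows "lagrange_weight T K i \<noteq> 0"
  using assms by (auto simp: lagrange_weight_def inj_on_def)

text \<open>The factor \<open>T i - T b\<close> cancels the one that \<open>b\<close> contributes to
  the denominator and kills the term at \<open>b\<close>. Divided differences on \<open>K\<close>
  and on \<open>K - {b}\<close> can thus be compared over one index set.\<close>

lemma sum_lagrange_weight_remove:
  assumes "finite K" "inj_on T K" "b \<in> K"
  shows "(\<Sum>i\<in>K - {b}. lagrange_weight T (K - {b}) i * h i)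
       = (\<Sum>i\<in>K. lagrange_weight T K i * (T i - T b) * h i)"
proof -
  have "(\<Sum>i\<in>K - {b}. lagrange_weight T (K - {b}) i * h i)
      = (\<Sum>i\<in>K - {b}. lagrange_weight T K i * (T i - T b) * h i)"
    using assms by (intro sum.cong refl) (subst lagrange_weight_remove, auto simp: inj_on_def)
  also have "\<dots> = (\<Sum>i\<in>K. lagrange_weight T K i * (T i - T b) * h i)"
    using assms by (intro sum.mono_neutral_left) auto
  finally show ?thesis .
qed

text \<open>Induction on the number of nodes, with an inner induction on the degree: splitting
  \<open>T i - y\<close> as \<open>(T i - T a) + (T a - y)\<close> leads either to one node less or
  to a lower degree.\<close>

lemma sum_lagrange_weight_power:
  assumes "finite K" "inj_on T K" "k + 1 < card K"
  shows "(\<Sum>i\<in>K. lagrange_weight T K i * (T i - y) ^ k) = 0"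
  using assms
proof (induction "card K" arbitrary: K k)
  case 0
  then show ?case by simp
next
  case (Suc n)
  note fin = \<open>finite K\<close> and inj = \<open>inj_on T K\<close>
  have IH: "(\<Sum>i\<in>K - {a}. lagrange_weight T (K - {a}) i * (T i - y) ^ l) = 0"
    if "a \<in> K" "l + 1 < n" for a l
    using Suc.hyps(2) that fin inj by (intro Suc.hyps(1)) (auto intro: inj_on_diff)
  have zero: "(\<Sum>i\<in>K. lagrange_weight T K i * (T i - y) ^ 0) = 0"
  proof -
    obtain a where a: "a \<in> K" using Suc.prems by fastforce
    have "card (K - {a}) \<noteq> 0" using Suc.prems a fin by simp
    hence "K - {a} \<noteq> {}" by (metis card.empty)
    then obtain b where b: "b \<in> K" "b \<noteq> a" by blast
    \<comment> \<open>This is the divided difference of the constant 1 at the nodes other than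
      \<open>x\<close>. Its value does not depend on \<open>x\<close>, so subtracting it for
      \<open>a\<close> and \<open>b\<close> isolates the sum of the weights.\<close>
    have *: "(\<Sum>i\<in>K. lagrange_weight T K i * (T i - T x)) = (if n = 1 then 1 else 0)"
      if x: "x \<in> K" for x
    proof (cases "n = 1")
      case True
      then obtain z where z: "K - {x} = {z}"
        using Suc.hyps(2) x fin by (metis card_1_singletonE card_Diff_singleton diff_Suc_1)
      show ?thesis
        using sum_lagrange_weight_remove[OF fin inj x, of "\<lambda>_. 1"] z True
        by (simp add: lagrange_weight_def)
    next
      case False
      hence "0 + 1 < n" using Suc.prems Suc.hyps(2) by simp
      from IH[OF x this] show ?thesis
        using sum_lagrange_weight_remove[OF fin inj x, of "\<lambda>_. 1"] False by simp
    qed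
    have "(T b - T a) * (\<Sum>i\<in>K. lagrange_weight T K i)
        = (\<Sum>i\<in>K. lagrange_weight T K i * (T i - T a)) - (\<Sum>i\<in>K. lagrange_weight T K i * (T i - T b))"
      by (simp add: sum_distrib_left sum_subtractf[symmetric] algebra_simps)
    also have "\<dots> = 0" using * a b by simp
    finally show ?thesis using b a inj by (auto simp: inj_on_def)
  qed
  show ?case using Suc.prems(3)
  proof (induction k)
    case 0
    then show ?case using zero by simp
  next
    case (Suc k)
    obtain a where a: "a \<in> K" using Suc.prems by fastforce
    have "(\<Sum>i\<in>K. lagrange_weight T K i * (T i - y) ^ Suc k)
        = (\<Sum>i\<in>K. lagrange_weight T K i * (T i - T a) * (T i - y) ^ k)
          + (T a - y) * (\<Sum>i\<in>K. lagrange_weight T K i * (T i - y) ^ k)"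
      by (simp add: sum_distrib_left sum.distrib[symmetric] algebra_simps)
    also have "\<dots> = (\<Sum>i\<in>K - {a}. lagrange_weight T (K - {a}) i * (T i - y) ^ k)"
      using Suc sum_lagrange_weight_remove[OF fin inj a, of "\<lambda>i. (T i - y) ^ k"] by simp
    also have "\<dots> = 0" using IH[OF a] Suc.prems Suc.hyps(2) \<open>Suc n = card K\<close> by simp
    finally show ?case .
  qed
qed

text \<open>The strict inequality makes order 0 a step function that vanishes at 0, as fits the
  half-open supports of the B-splines of order 1.\<close>

definition trunc_power :: "nat \<Rightarrow> real \<Rightarrow> real" where
  "trunc_power k x = (if 0 < x then x ^ k else 0)"

lemma trunc_power_Suc: "trunc_power (Suc k) x = x * trunc_power k x"
  by (simp add: trunc_power_def)

text \<open>Turns a truncated power around up to a polynomial, which the jumps annihilate. At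
  \<open>x = 0\<close> the identity fails for \<open>k = 0\<close>.\<close>

lemma trunc_power_reflect:
  "x \<noteq> 0 \<Longrightarrow> trunc_power k x = x ^ k + (- 1) ^ Suc k * trunc_power k (- x)"
  by (auto simp: trunc_power_def power_mult_distrib[symmetric])

text \<open>By \<open>sum_lagrange_weight_remove\<close> both splines of lower order become sums
  over the full knot set, and the leading knot differences cancel the denominators of the
  recursion.\<close>

lemma bspline_trunc_power:
  assumes "strict_mono_on {j..j + Suc k} T"
  shows "bspline T j (Suc k) t
       = (T (j + Suc k) - T j)
         * (\<Sum>i\<in>{j..j + Suc k}. lagrange_weight T {j..j + Suc k} i * trunc_power k (T i - t))"
  using assms
proof (induction k arbitrary: j)
  case 0
  have lt: "T j < T (Suc j)" using 0 by (auto simp: strict_mono_on_def)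
  have K: "{j..j + Suc 0} = {j, Suc j}" "{j, Suc j} - {j} = {Suc j}" "{j, Suc j} - {Suc j} = {j}"
    by auto
  have "D * (inverse (- D) * x + inverse D * y) = y - x" if "D \<noteq> 0" for D x y :: real
    using that by (simp add: field_simps)
  from this[of "T (Suc j) - T j" "trunc_power 0 (T j - t)" "trunc_power 0 (T (Suc j) - t)"]
  have "(T (j + Suc 0) - T j)
         * (\<Sum>i\<in>{j..j + Suc 0}. lagrange_weight T {j..j + Suc 0} i * trunc_power 0 (T i - t))
      = trunc_power 0 (T (Suc j) - t) - trunc_power 0 (T j - t)"
    using lt unfolding K by (simp add: lagrange_weight_def K)
  also have "\<dots> = bspline T j (Suc 0) t"
    using lt by (auto simp: trunc_power_def indicator_def)
  finally show ?case ..
next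
  case (Suc k)
  let ?K = "{j..j + Suc (Suc k)}" and ?b = "j + Suc (Suc k)"
  let ?w = "lagrange_weight T ?K"
  have inj: "inj_on T ?K" using Suc.prems by (rule strict_mono_on_imp_inj_on)
  have L: "{j..j + Suc k} = ?K - {?b}" and R: "{Suc j..Suc j + Suc k} = ?K - {j}" by auto
  have smL: "strict_mono_on {j..j + Suc k} T" and smR: "strict_mono_on {Suc j..Suc j + Suc k} T"
    using Suc.prems by (auto simp: strict_mono_on_def)
  have lt: "T j < T (j + Suc k)" "T (Suc j) < T ?b"
    using Suc.prems by (auto simp: strict_mono_on_def)
  have "bspline T j (Suc k) t = (T (j + Suc k) - T j)
         * (\<Sum>i\<in>?K. ?w i * (T i - T ?b) * trunc_power k (T i - t))"
    using Suc.IH[OF smL] sum_lagrange_weight_remove[OF _ inj, of ?b "\<lambda>i. trunc_power k (T i - t)"]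
    unfolding L by simp
  moreover have "bspline T (Suc j) (Suc k) t = (T ?b - T (Suc j))
         * (\<Sum>i\<in>?K. ?w i * (T i - T j) * trunc_power k (T i - t))"
    using Suc.IH[OF smR] sum_lagrange_weight_remove[OF _ inj, of j "\<lambda>i. trunc_power k (T i - t)"]
    unfolding R by simp
  ultimately have "bspline T j (Suc (Suc k)) t
      = (t - T j) * (\<Sum>i\<in>?K. ?w i * (T i - T ?b) * trunc_power k (T i - t))
        + (T ?b - t) * (\<Sum>i\<in>?K. ?w i * (T i - T j) * trunc_power k (T i - t))"
    using lt by (simp add: Let_def)
  \<comment> \<open>termwise \<open>(t - T j) (T i - T b) + (T b - t) (T i - T j) = (T b - T j) (T i - t)\<close>\<close>
  also have "\<dots> = (T ?b - T j) * (\<Sum>i\<in>?K. ?w i * trunc_power (Suc k) (T i - t))"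
    unfolding sum_distrib_left sum.distrib[symmetric] trunc_power_Suc
    by (intro sum.cong refl) (simp add: algebra_simps)
  finally show ?case .
qed

text \<open>The derivative of order \<open>m - 1\<close> of \<open>spline N m c T\<close> jumps at the knot \<open>T i\<close> by \<open>jump N m c T i\<close>
  times \<open>(- 1) ^ m * (m - 1)!\<close>.\<close>

definition jump_weight :: "nat \<Rightarrow> (nat \<Rightarrow> real) \<Rightarrow> nat \<Rightarrow> nat \<Rightarrow> real" where
  "jump_weight m T l i = (if i \<in> {l..l + m}
     then (T (l + m) - T l) * lagrange_weight T {l..l + m} i else 0)"

definition jump :: "nat \<Rightarrow> nat \<Rightarrow> (nat \<Rightarrow> complex) \<Rightarrow> (nat \<Rightarrow> real) \<Rightarrow> nat \<Rightarrow> complex" where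
  "jump N m c T i = (\<Sum>l=1..N. of_real (jump_weight m T l i) * c l)"

text \<open>An exchange of summation that serves twice: truncated powers for \<open>h\<close> give
  the spline, and ordinary powers give the vanishing moments.\<close>

lemma sum_jump:
  "(\<Sum>i=1..N + m. jump N m c T i * of_real (h i))
     = (\<Sum>l=1..N. c l * of_real ((T (l + m) - T l)
         * (\<Sum>i\<in>{l..l + m}. lagrange_weight T {l..l + m} i * h i)))"
proof -
  have "(\<Sum>i=1..N + m. jump N m c T i * of_real (h i))
      = (\<Sum>l=1..N. \<Sum>i=1..N + m. of_real (jump_weight m T l i) * c l * of_real (h i))"
    unfolding jump_def sum_distrib_right by (rule sum.swap)
  also have "\<dots> = (\<Sum>l=1..N. c l * (\<Sum>i\<in>{l..l + m}.
                   of_real ((T (l + m) - T l) * lagrange_weight T {l..l + m} i * h i)))"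
  proof (intro sum.cong refl)
    fix l assume l: "l \<in> {1..N}"
    have "(\<Sum>i=1..N + m. of_real (jump_weight m T l i) * c l * of_real (h i))
        = (\<Sum>i\<in>{l..l + m}. of_real (jump_weight m T l i) * c l * of_real (h i))"
      using l by (intro sum.mono_neutral_right) (auto simp: jump_weight_def)
    thus "(\<Sum>i=1..N + m. of_real (jump_weight m T l i) * c l * of_real (h i))
        = c l * (\<Sum>i\<in>{l..l + m}. of_real ((T (l + m) - T l) * lagrange_weight T {l..l + m} i * h i))"
      by (simp add: jump_weight_def sum_distrib_left mult_ac)
  qed
  finally show ?thesis by (simp add: sum_distrib_left mult_ac)
qed

lemma spline_trunc_power:
  assumes "strict_mono_on {1..N + Suc k} T"
  shows "spline N (Suc k) c T t
       = (\<Sum>i=1..N + Suc k. jump N (Suc k) c T i * of_real (trunc_power k (T i - t)))"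
  unfolding sum_jump spline_def
proof (intro sum.cong refl)
  fix l assume "l \<in> {1..N}"
  hence "strict_mono_on {l..l + Suc k} T" using assms by (auto simp: strict_mono_on_def)
  thus "c l * complex_of_real (bspline T l (Suc k) t) =
         c l * complex_of_real ((T (l + Suc k) - T l) *
           (\<Sum>i = l..l + Suc k. lagrange_weight T {l..l + Suc k} i * trunc_power k (T i - t)))"
    by (subst bspline_trunc_power) auto
qed

text \<open>These vanishing moments make the spline zero left of its knots, cancel the Taylor terms
  in its Fourier transform and allow its reflection.\<close>

lemma sum_jump_power:
  assumes "inj_on T {1..N + m}" "k < m"
  shows "(\<Sum>i=1..N + m. jump N m c T i * of_real ((T i - y) ^ k)) = 0"
  unfolding sum_jump
proof (intro sum.neutral ballI)
  fix l assume "l \<in> {1..N}"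
  hence "inj_on T {l..l + m}" by (intro inj_on_subset[OF assms(1)]) auto
  from sum_lagrange_weight_power[OF _ this, of k y]
  show "c l * complex_of_real ((T (l + m) - T l)
         * (\<Sum>i = l..l + m. lagrange_weight T {l..l + m} i * (T i - y) ^ k)) = 0"
    using assms(2) by simp
qed

text \<open>For fixed knots \<open>jump\<close> is a linear form in the coefficients; this says that
  the form is not zero.\<close>

lemma jump_weight_nonzero:
  assumes "inj_on T {1..N + m}" "N \<ge> 1" "m \<ge> 1" "i \<in> {1..N + m}"
  shows "\<exists>l\<in>{1..N}. jump_weight m T l i \<noteq> 0"
proof
  \<comment> \<open>A B-spline that has \<open>T i\<close> among its knots: the one starting there
    if \<open>i\<close> is at most \<open>N\<close>, otherwise the last one.\<close>
  show l: "min i N \<in> {1..N}" using assms by auto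
  have inj: "inj_on T {min i N..min i N + m}"
    by (rule inj_on_subset[OF assms(1)]) (use assms in auto)
  have "i \<in> {min i N..min i N + m}" using assms(4) by auto
  moreover from this have "lagrange_weight T {min i N..min i N + m} i \<noteq> 0"
    by (intro lagrange_weight_nonzero inj) auto
  moreover have "T (min i N + m) \<noteq> T (min i N)"
    using inj_onD[OF inj, of "min i N + m" "min i N"] assms(3) by auto
  ultimately show "jump_weight m T (min i N) i \<noteq> 0" by (simp add: jump_weight_def)
qed

subsection \<open>Phase retrieval for exponential sums\<close>

text \<open>Shifting \<omega> by \<tau> and subtracting a multiple of the original relation removes
  the frequency \<open>y\<close>, which leaves a relation on fewer frequencies.\<close>

lemma exp_linear_independent:
  fixes \<gamma> :: "real \<Rightarrow> complex"
  assumes "finite X" "\<And>\<omega>. (\<Sum>x\<in>X. \<gamma> x * exp (- \<i> * of_real (\<omega> * x))) = 0" "x \<in> X"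
  shows "\<gamma> x = 0"
  using assms
proof (induction X arbitrary: \<gamma> x rule: finite_induct)
  case empty
  then show ?case by simp
next
  case (insert y X)
  let ?e = "\<lambda>(\<omega>::real) x. exp (- \<i> * of_real (\<omega> * x))"
  have sum0: "\<gamma> y * ?e \<omega> y + (\<Sum>x\<in>X. \<gamma> x * ?e \<omega> x) = 0" for \<omega>
    using insert.prems(1)[of \<omega>] insert.hyps by simp
  have *: "\<gamma> x = 0" if x: "x \<in> X" for x
  proof -
    have xy: "x \<noteq> y" using x insert.hyps by auto
    \<comment> \<open>With this shift the exponentials at \<open>x\<close> and \<open>y\<close>
      differ by the factor -1, so the coefficient at \<open>x\<close> survives the
      elimination.\<close>
    define \<tau> where "\<tau> = pi / (x - y)"
    have "(\<Sum>z\<in>X. (\<gamma> z * (?e \<tau> z - ?e \<tau> y)) * ?e \<omega> z) = 0" for \<omega>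
    proof -
      have "(\<Sum>z\<in>X. (\<gamma> z * (?e \<tau> z - ?e \<tau> y)) * ?e \<omega> z)
          = (\<gamma> y * ?e (\<omega> + \<tau>) y + (\<Sum>z\<in>X. \<gamma> z * ?e (\<omega> + \<tau>) z))
            - ?e \<tau> y * (\<gamma> y * ?e \<omega> y + (\<Sum>z\<in>X. \<gamma> z * ?e \<omega> z))"
        by (simp add: sum_distrib_left sum_subtractf[symmetric] algebra_simps exp_add[symmetric])
      also have "\<dots> = 0" by (simp only: sum0 mult_zero_right diff_zero)
      finally show ?thesis .
    qed
    from insert.IH[OF this x] have "\<gamma> x * (?e \<tau> x - ?e \<tau> y) = 0" .
    moreover have "?e \<tau> x \<noteq> ?e \<tau> y"
    proof
      assume "?e \<tau> x = ?e \<tau> y"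
      hence "exp (- \<i> * of_real (\<tau> * x) - - \<i> * of_real (\<tau> * y)) = 1"
        by (simp only: exp_diff) simp
      moreover have "- \<i> * of_real (\<tau> * x) - - \<i> * of_real (\<tau> * y) = - (\<i> * of_real (\<tau> * (x - y)))"
        by (simp add: algebra_simps)
      ultimately show False using xy by (simp add: \<tau>_def exp_minus)
    qed
    ultimately show ?thesis by simp
  qed
  hence "\<gamma> y * ?e 0 y = 0" using sum0[of 0] by simp
  with * insert.prems(2) show ?case by auto
qed

text \<open>Frequencies may coincide within either family, so independence determines only the total
  coefficient at each frequency.\<close>

lemma sum_level_eq:
  fixes \<alpha> \<beta> :: "'i \<Rightarrow> complex" and u v :: "'i \<Rightarrow> real"
  assumes "finite P"
    and eq: "\<And>\<omega>::real. (\<Sum>p\<in>P. \<alpha> p * exp (- \<i> * of_real (\<omega> * u p)))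
                     = (\<Sum>p\<in>P. \<beta> p * exp (- \<i> * of_real (\<omega> * v p)))"
  shows "(\<Sum>p | p \<in> P \<and> u p = x. \<alpha> p) = (\<Sum>p | p \<in> P \<and> v p = x. \<beta> p)"
proof -
  let ?X = "insert x (u ` P \<union> v ` P)"
  define \<gamma> where "\<gamma> x = (\<Sum>p | p \<in> P \<and> u p = x. \<alpha> p) - (\<Sum>p | p \<in> P \<and> v p = x. \<beta> p)" for x
  have group: "(\<Sum>x\<in>?X. (\<Sum>p | p \<in> P \<and> w p = x. \<delta> p) * exp (- \<i> * of_real (\<omega> * x)))
      = (\<Sum>p\<in>P. \<delta> p * exp (- \<i> * of_real (\<omega> * w p)))"
    if "w ` P \<subseteq> ?X" for w :: "'i \<Rightarrow> real" and \<delta> :: "'i \<Rightarrow> complex" and \<omega> :: real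
  proof -
    have "(\<Sum>x\<in>?X. (\<Sum>p | p \<in> P \<and> w p = x. \<delta> p) * exp (- \<i> * of_real (\<omega> * x)))
        = (\<Sum>x\<in>?X. \<Sum>p | p \<in> P \<and> w p = x. \<delta> p * exp (- \<i> * of_real (\<omega> * w p)))"
      unfolding sum_distrib_right by (intro sum.cong refl) auto
    also have "\<dots> = (\<Sum>p\<in>P. \<delta> p * exp (- \<i> * of_real (\<omega> * w p)))"
      using assms(1) that by (intro sum.group) auto
    finally show ?thesis .
  qed
  have "(\<Sum>x\<in>?X. \<gamma> x * exp (- \<i> * of_real (\<omega> * x))) = 0" for \<omega>
    unfolding \<gamma>_def left_diff_distrib sum_subtractf
    by (subst group, blast, subst group, blast) (use eq[of \<omega>] in simp)
  from exp_linear_independent[OF _ this, of x] show ?thesis using assms(1) by (simp add: \<gamma>_def)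
qed

text \<open>Linear independence over the integers, with the positive and the negative coefficients
  kept apart as multisets. Relations between knot differences then become equalities of small
  explicit multisets.\<close>

definition dissociated :: "'i set \<Rightarrow> ('i \<Rightarrow> 'a::comm_monoid_add) \<Rightarrow> bool" where
  "dissociated I T \<longleftrightarrow> (\<forall>A B. set_mset A \<subseteq> I \<longrightarrow> set_mset B \<subseteq> I \<longrightarrow>
     (\<Sum>i\<in>#A. T i) = (\<Sum>i\<in>#B. T i) \<longrightarrow> A = B)"

lemma dissociatedD:
  "\<lbrakk>dissociated I T; (\<Sum>i\<in>#A. T i) = (\<Sum>i\<in>#B. T i); set_mset A \<subseteq> I; set_mset B \<subseteq> I\<rbrakk> \<Longrightarrow> A = B"
  unfolding dissociated_def by blast

lemma dissociated_imp_inj_on: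
  assumes "dissociated I T"
  shows "inj_on T I"
  using dissociatedD[OF assms, of "{#_#}" "{#_#}"] by (auto intro!: inj_onI)

lemma dissociated_diff_eq:
  fixes T :: "'i \<Rightarrow> 'a::ab_group_add"
  assumes "dissociated I T" "T i - T j = T k - T l" "i \<noteq> j" "{i, j, k, l} \<subseteq> I"
  shows "i = k \<and> j = l"
proof -
  have "{#i, l#} = {#k, j#}"
    using assms(2,4) by (intro dissociatedD[OF assms(1)]) (auto simp: algebra_simps)
  thus ?thesis using assms(3) by (auto simp: add_eq_conv_ex)
qed

text \<open>Moving the negative terms across gives \<open>{#p, q', s#} = {#r, q, p'#}\<close>.
  Either \<open>p\<close> meets \<open>p'\<close>, or it meets \<open>r\<close> and what remains
  forces \<open>q = q'\<close>.\<close>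

lemma dissociated_diff_add_eq:
  fixes T :: "'i \<Rightarrow> 'a::ab_group_add"
  assumes "dissociated I T" "(T p - T q) - (T p' - T q') = T r - T s"
    "p \<noteq> q" "p' \<noteq> q'" "r \<noteq> s" "{p, q, p', q', r, s} \<subseteq> I"
  shows "p = p' \<or> q = q'"
proof -
  have "T p + (T q' + T s) = T r + (T q + T p')"
    using assms(2) by (simp add: algebra_simps)
  hence "{#p, q', s#} = {#r, q, p'#}"
    using assms(6) by (intro dissociatedD[OF assms(1)]) auto
  moreover from this have "p \<in># {#r, q, p'#}" by (metis union_single_eq_member)
  hence "p = r \<or> p = p'" using assms(3) by simp
  moreover have "q' = q" if "p = r"
  proof -
    have "{#q', s#} = {#q, p'#}" using calculation(1) that by simp
    hence "q' \<in># {#q, p'#}" by (metis union_single_eq_member)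
    thus ?thesis using assms(4) by simp
  qed
  ultimately show ?thesis by blast
qed

text \<open>Relative to a base point \<open>o'\<close>, each \<open>S j\<close> gives a pair
  \<open>(p j, q j)\<close>. Since \<open>S j - S k\<close> is again a difference of
  \<open>T\<close>, any two pairs agree in a component; a common second component yields a
  translation, a common first one a reflection.\<close>

lemma dissociated_turnpike:
  fixes S T :: "'i \<Rightarrow> 'a::ab_group_add"
  assumes fin: "finite I" and diss: "dissociated I T" and S: "inj_on S I"
    and diff: "\<And>j k. \<lbrakk>j \<in> I; k \<in> I; j \<noteq> k\<rbrakk> \<Longrightarrow> \<exists>p\<in>I. \<exists>q\<in>I. p \<noteq> q \<and> S j - S k = T p - T q"
  shows "\<exists>\<pi> t0. bij_betw \<pi> I I \<and>
           ((\<forall>j\<in>I. S j = t0 + T (\<pi> j)) \<or> (\<forall>j\<in>I. S j = t0 - T (\<pi> j)))"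
proof (cases "I = {}")
  case True
  then show ?thesis by (auto intro!: exI[of _ id])
next
  case False
  then obtain o' where o: "o' \<in> I" by blast
  have "\<forall>j. \<exists>p q. j \<in> I - {o'} \<longrightarrow> p \<in> I \<and> q \<in> I \<and> p \<noteq> q \<and> S j - S o' = T p - T q"
    using diff o by (metis DiffE insertI1)
  then obtain p q where pq: "\<And>j. j \<in> I \<Longrightarrow> j \<noteq> o' \<Longrightarrow>
      p j \<in> I \<and> q j \<in> I \<and> p j \<noteq> q j \<and> S j - S o' = T (p j) - T (q j)"
    by (metis DiffI singletonD)
  have adj: "p j = p k \<or> q j = q k" if "j \<in> I - {o'}" "k \<in> I - {o'}" for j k
  proof (cases "j = k")
    case False
    obtain r s where rs: "r \<in> I" "s \<in> I" "r \<noteq> s" "S j - S k = T r - T s"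
      using diff[of j k] \<open>j \<noteq> k\<close> \<open>j \<in> I - {o'}\<close> \<open>k \<in> I - {o'}\<close> by auto
    have "S j - S k = (S j - S o') - (S k - S o')" by simp
    also have "\<dots> = (T (p j) - T (q j)) - (T (p k) - T (q k))" using pq that by simp
    finally show ?thesis
      using dissociated_diff_add_eq[OF diss, of "p j" "q j" "p k" "q k" r s] rs pq that by auto
  qed simp
  \<comment> \<open>If \<open>j\<close> and \<open>k\<close> differ in \<open>q\<close>, they share
    \<open>p\<close>. An \<open>l\<close> with another value of \<open>p\<close> would have to share
    \<open>q\<close> with both.\<close>
  have "(\<exists>a\<in>I. \<forall>j\<in>I - {o'}. q j = a) \<or> (\<exists>a\<in>I. \<forall>j\<in>I - {o'}. p j = a)"
  proof (rule ccontr)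
    assume neg: "\<not> ?thesis"
    then obtain j where j: "j \<in> I - {o'}" using o by blast
    then obtain k where k: "k \<in> I - {o'}" "q k \<noteq> q j" using neg pq by blast
    have pjk: "p j = p k" using adj[OF j k(1)] k(2) by auto
    obtain l where l: "l \<in> I - {o'}" "p l \<noteq> p j" using neg j pq by blast
    show False using adj[OF l(1) j] adj[OF l(1) k(1)] l(2) k(2) pjk by auto
  qed
  then show ?thesis
  proof
    assume "\<exists>a\<in>I. \<forall>j\<in>I - {o'}. q j = a"
    then obtain a where a: "a \<in> I" "\<And>j. j \<in> I \<Longrightarrow> j \<noteq> o' \<Longrightarrow> q j = a" by blast
    \<comment> \<open>The value \<open>a\<close> at \<open>o'\<close> extends the formula to the
      base point; injectivity is then inherited from \<open>S\<close>.\<close>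
    define \<pi> where "\<pi> j = (if j = o' then a else p j)" for j
    have eq: "S j = (S o' - T a) + T (\<pi> j)" if "j \<in> I" for j
      using pq[of j] a that by (auto simp: \<pi>_def algebra_simps)
    hence "inj_on \<pi> I" using S by (metis (no_types, lifting) inj_on_def)
    moreover have "\<pi> ` I \<subseteq> I" using pq a by (auto simp: \<pi>_def)
    ultimately have "bij_betw \<pi> I I" by (simp add: bij_betw_def endo_inj_surj fin)
    with eq show ?thesis by blast
  next
    assume "\<exists>a\<in>I. \<forall>j\<in>I - {o'}. p j = a"
    then obtain a where a: "a \<in> I" "\<And>j. j \<in> I \<Longrightarrow> j \<noteq> o' \<Longrightarrow> p j = a" by blast
    define \<pi> where "\<pi> j = (if j = o' then a else q j)" for j
    have eq: "S j = (S o' + T a) - T (\<pi> j)" if "j \<in> I" for j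
      using pq[of j] a that by (auto simp: \<pi>_def algebra_simps)
    hence "inj_on \<pi> I" using S by (metis (no_types, lifting) inj_on_def)
    moreover have "\<pi> ` I \<subseteq> I" using pq a by (auto simp: \<pi>_def)
    ultimately have "bij_betw \<pi> I I" by (simp add: bij_betw_def endo_inj_surj fin)
    with eq show ?thesis by blast
  qed
qed

text \<open>Since the entries sum to zero, each column of the rank-one matrix does too, so its
  diagonal entry is determined by the others. Comparing column \<open>k\<close> then gives the
  factor \<open>cnj (a k) / cnj (b k)\<close>.\<close>

lemma rank_one_eq:
  fixes a b :: "'i \<Rightarrow> complex"
  assumes fin: "finite I" and nz: "\<And>j. j \<in> I \<Longrightarrow> a j \<noteq> 0"
    and suma: "(\<Sum>j\<in>I. a j) = 0" and sumb: "(\<Sum>j\<in>I. b j) = 0"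
    and off: "\<And>j k. \<lbrakk>j \<in> I; k \<in> I; j \<noteq> k\<rbrakk> \<Longrightarrow> a j * cnj (a k) = b j * cnj (b k)"
  shows "\<exists>u. cmod u = 1 \<and> (\<forall>j\<in>I. b j = u * a j)"
proof (cases "I = {}")
  case True
  then show ?thesis by (auto intro: exI[of _ 1])
next
  case False
  then obtain k where k: "k \<in> I" by blast
  have diag: "a k * cnj (a k) = b k * cnj (b k)"
  proof -
    have "0 = (\<Sum>j\<in>I. a j) * cnj (a k)" "0 = (\<Sum>j\<in>I. b j) * cnj (b k)" using suma sumb by auto
    hence "a k * cnj (a k) + (\<Sum>j\<in>I - {k}. a j * cnj (a k))
         = b k * cnj (b k) + (\<Sum>j\<in>I - {k}. b j * cnj (b k))"
      unfolding sum_distrib_right using fin k by (simp add: sum.remove[of I k])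
    moreover have "(\<Sum>j\<in>I - {k}. a j * cnj (a k)) = (\<Sum>j\<in>I - {k}. b j * cnj (b k))"
      using off k by (intro sum.cong) auto
    ultimately show ?thesis by simp
  qed
  have bk: "cmod (b k) = cmod (a k)"
    using diag by (metis complex_norm_square norm_ge_zero of_real_eq_iff power2_eq_iff_nonneg)
  hence bk0: "b k \<noteq> 0" using nz[OF k] by auto
  show ?thesis
  proof (intro exI conjI ballI)
    show "cmod (cnj (a k) / cnj (b k)) = 1" using bk nz[OF k] by (simp add: norm_divide)
    fix j assume j: "j \<in> I"
    hence "a j * cnj (a k) = b j * cnj (b k)" using off[OF j k] diag by (cases "j = k") auto
    thus "b j = cnj (a k) / cnj (b k) * a j" using bk0 by (simp add: field_simps)
  qed
qed

lemma norm_exp_sum_square: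
  fixes a :: "'i \<Rightarrow> complex" and T :: "'i \<Rightarrow> real"
  shows "of_real ((cmod (\<Sum>j\<in>I. a j * exp (- \<i> * of_real (\<omega> * T j))))\<^sup>2)
       = (\<Sum>p\<in>I \<times> I. (a (fst p) * cnj (a (snd p))) * exp (- \<i> * of_real (\<omega> * (T (fst p) - T (snd p)))))"
  unfolding complex_norm_square cnj_sum sum_product sum.cartesian_product
  by (intro sum.cong refl) (auto simp: exp_cnj algebra_simps exp_add[symmetric] exp_diff exp_minus field_simps)

text \<open>Each nonzero difference of \<open>T\<close> comes from a single pair with nonzero
  product, so it must also occur among the differences of \<open>S\<close>, although those may a
  priori coincide with one another.\<close>

lemma exp_sum_phase_retrieval:
  fixes a b :: "'i \<Rightarrow> complex" and S T :: "'i \<Rightarrow> real"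
  assumes fin: "finite I" and nz: "\<And>j. j \<in> I \<Longrightarrow> a j \<noteq> 0"
    and suma: "(\<Sum>j\<in>I. a j) = 0" and sumb: "(\<Sum>j\<in>I. b j) = 0"
    and diss: "dissociated I T" and S: "inj_on S I"
    and eq: "\<And>\<omega>::real. cmod (\<Sum>j\<in>I. a j * exp (- \<i> * of_real (\<omega> * T j)))
                     = cmod (\<Sum>j\<in>I. b j * exp (- \<i> * of_real (\<omega> * S j)))"
  shows "\<exists>\<pi> t0 u. bij_betw \<pi> I I \<and> cmod u = 1 \<and>
           ((\<forall>j\<in>I. S j = t0 + T (\<pi> j) \<and> b j = u * a (\<pi> j)) \<or>
            (\<forall>j\<in>I. S j = t0 - T (\<pi> j) \<and> b j = u * cnj (a (\<pi> j))))"
proof -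
  define A where "A x = {p. p \<in> I \<times> I \<and> T (fst p) - T (snd p) = x}" for x
  define B where "B x = {p. p \<in> I \<times> I \<and> S (fst p) - S (snd p) = x}" for x
  have level: "(\<Sum>p\<in>A x. a (fst p) * cnj (a (snd p))) = (\<Sum>p\<in>B x. b (fst p) * cnj (b (snd p)))"
    for x
    unfolding A_def B_def
    by (intro sum_level_eq) (use fin in simp, simp only: norm_exp_sum_square[symmetric] eq)
  have T: "inj_on T I" by (rule dissociated_imp_inj_on[OF diss])
  have A_sing: "A (T j - T k) = {(j, k)}" if "j \<in> I" "k \<in> I" "j \<noteq> k" for j k
  proof (intro set_eqI iffI)
    fix p assume "p \<in> A (T j - T k)"
    thus "p \<in> {(j, k)}"
      using dissociated_diff_eq[OF diss, of j k "fst p" "snd p"] that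
      by (auto simp: A_def prod_eq_iff mem_Times_iff)
  qed (use that in \<open>auto simp: A_def\<close>)
  let ?P = "{p \<in> I \<times> I. fst p \<noteq> snd p}"
  let ?d = "\<lambda>T p. T (fst p) - T (snd p) :: real"
  have finP: "finite ?P" using fin by simp
  have sub: "?d T ` ?P \<subseteq> ?d S ` ?P"
  proof
    fix x assume "x \<in> ?d T ` ?P"
    then obtain j k where jk: "j \<in> I" "k \<in> I" "j \<noteq> k" and x: "x = T j - T k" by auto
    have "(\<Sum>p\<in>A (T j - T k). a (fst p) * cnj (a (snd p))) = a j * cnj (a k)"
      using A_sing jk by simp
    with level[of "T j - T k"] nz[of j] nz[of k] jk
    have "(\<Sum>p\<in>B (T j - T k). b (fst p) * cnj (b (snd p))) \<noteq> 0" by auto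
    hence "B (T j - T k) \<noteq> {}" by auto
    then obtain r s where "r \<in> I" "s \<in> I" "S r - S s = T j - T k" by (auto simp: B_def)
    moreover from this have "r \<noteq> s" using inj_onD[OF T, of j k] jk by auto
    ultimately show "x \<in> ?d S ` ?P" unfolding x by (intro image_eqI[of _ _ "(r, s)"]) auto
  qed
  have injT: "inj_on (?d T) ?P"
  proof (intro inj_onI)
    fix p q assume "p \<in> ?P" "q \<in> ?P" "?d T p = ?d T q"
    thus "p = q"
      using dissociated_diff_eq[OF diss, of "fst p" "snd p" "fst q" "snd q"]
      by (auto simp: prod_eq_iff mem_Times_iff)
  qed
  \<comment> \<open>By counting: the differences of \<open>T\<close> are distinct, so those of
    \<open>S\<close>, indexed by the same set, cannot be more numerous.\<close>
  have "?d T ` ?P = ?d S ` ?P"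
    using card_image_le[OF finP, of "?d S"] card_image[OF injT] finP sub
    by (intro card_seteq) auto
  hence "\<exists>p\<in>I. \<exists>q\<in>I. p \<noteq> q \<and> S j - S k = T p - T q" if "j \<in> I" "k \<in> I" "j \<noteq> k" for j k
  proof -
    have "S j - S k \<in> ?d T ` ?P" unfolding \<open>?d T ` ?P = ?d S ` ?P\<close>
      using that by (intro image_eqI[of _ _ "(j, k)"]) auto
    then obtain r s where "r \<in> I" "s \<in> I" "r \<noteq> s" "S j - S k = T r - T s" by auto
    thus ?thesis by blast
  qed
  from dissociated_turnpike[OF fin diss S this]
  obtain \<pi> t0 where \<pi>: "bij_betw \<pi> I I"
    and alt: "(\<forall>j\<in>I. S j = t0 + T (\<pi> j)) \<or> (\<forall>j\<in>I. S j = t0 - T (\<pi> j))" by blast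
  have \<pi>I: "\<pi> j \<in> I" if "j \<in> I" for j using \<pi> that by (auto simp: bij_betw_def)
  have \<pi>_inj: "\<pi> j = \<pi> k \<longleftrightarrow> j = k" if "j \<in> I" "k \<in> I" for j k
    using \<pi> that by (auto simp: bij_betw_def inj_on_def)
  have sum\<pi>: "(\<Sum>j\<in>I. a (\<pi> j)) = 0" using sum.reindex_bij_betw[OF \<pi>, of a] suma by simp
  from alt show ?thesis
  proof
    assume *: "\<forall>j\<in>I. S j = t0 + T (\<pi> j)"
    have "a (\<pi> j) * cnj (a (\<pi> k)) = b j * cnj (b k)" if "j \<in> I" "k \<in> I" "j \<noteq> k" for j k
    proof -
      have "B (T (\<pi> j) - T (\<pi> k)) = {(j, k)}"
      proof (intro set_eqI iffI)
        fix p assume p: "p \<in> B (T (\<pi> j) - T (\<pi> k))"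
        hence "T (\<pi> j) - T (\<pi> k) = T (\<pi> (fst p)) - T (\<pi> (snd p))"
          using * by (auto simp: B_def mem_Times_iff)
        from dissociated_diff_eq[OF diss this] show "p \<in> {(j, k)}"
          using that p \<pi>I \<pi>_inj by (auto simp: B_def prod_eq_iff mem_Times_iff)
      qed (use * that in \<open>auto simp: B_def\<close>)
      with level[of "T (\<pi> j) - T (\<pi> k)"] A_sing[of "\<pi> j" "\<pi> k"] that \<pi>I \<pi>_inj show ?thesis by simp
    qed
    from rank_one_eq[OF fin _ sum\<pi> sumb this] nz \<pi>I
    obtain u where "cmod u = 1" "\<forall>j\<in>I. b j = u * a (\<pi> j)" by blast
    with * \<pi> show ?thesis by blast
  next
    assume *: "\<forall>j\<in>I. S j = t0 - T (\<pi> j)"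
    have "cnj (a (\<pi> j)) * cnj (cnj (a (\<pi> k))) = b j * cnj (b k)"
      if "j \<in> I" "k \<in> I" "j \<noteq> k" for j k
    proof -
      \<comment> \<open>Reflection exchanges the two indices, which conjugates the product of the
        masses.\<close>
      have "B (T (\<pi> k) - T (\<pi> j)) = {(j, k)}"
      proof (intro set_eqI iffI)
        fix p assume p: "p \<in> B (T (\<pi> k) - T (\<pi> j))"
        hence "T (\<pi> k) - T (\<pi> j) = T (\<pi> (snd p)) - T (\<pi> (fst p))"
          using * by (auto simp: B_def mem_Times_iff)
        from dissociated_diff_eq[OF diss this] show "p \<in> {(j, k)}"
          using that p \<pi>I \<pi>_inj by (auto simp: B_def prod_eq_iff mem_Times_iff)
      qed (use * that in \<open>auto simp: B_def\<close>)
      with level[of "T (\<pi> k) - T (\<pi> j)"] A_sing[of "\<pi> k" "\<pi> j"] that \<pi>I \<pi>_inj show ?thesis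
        by (simp add: mult.commute)
    qed
    moreover have "(\<Sum>j\<in>I. cnj (a (\<pi> j))) = 0" using sum\<pi> by (metis cnj_sum complex_cnj_zero)
    ultimately obtain u where "cmod u = 1" "\<forall>j\<in>I. b j = u * cnj (a (\<pi> j))"
      using rank_one_eq[OF fin, of "\<lambda>j. cnj (a (\<pi> j))" b] nz \<pi>I sumb by auto
    with * \<pi> show ?thesis by blast
  qed
qed

subsection \<open>Fourier transforms of splines\<close>

text \<open>The truncated power does not decay to the left, hence the cutoff at \<open>L\<close>. It
  costs boundary terms that are polynomial in \<open>x - L\<close> of degree at most
  \<open>k\<close>.\<close>

lemma trunc_power_exp_integral:
  fixes s :: complex and L x :: real and k :: nat
  assumes "L \<le> x"
  defines "g \<equiv> \<lambda>t. of_real (indicator {L..} t * trunc_power k (x - t)) * exp (s * of_real t)"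
  shows "integrable lborel g"
    and "s ^ Suc k * (LINT t|lborel. g t)
       = fact k * exp (s * of_real x)
         - (\<Sum>i\<le>k. fact k / fact i * s ^ i * exp (s * of_real L) * of_real ((x - L) ^ i))"
proof -
  define h where "h t = complex_of_real ((x - t) ^ k) * exp (s * of_real t)" for t
  have h: "set_integrable lborel {L..x} h"
    unfolding h_def by (intro borel_integrable_atLeastAtMost' continuous_intros)
  have g_meas: "g \<in> borel_measurable lborel"
    unfolding g_def trunc_power_def by measurable
  \<comment> \<open>At \<open>t = x\<close> the two sides can differ when
    \<open>k = 0\<close>.\<close>
  have ae: "AE t in lborel. g t = indicator {L..x} t *\<^sub>R h t"
    using AE_lborel_singleton[of x]
    by eventually_elim (auto simp: g_def h_def trunc_power_def indicator_def)
  show "integrable lborel g"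
    using h[unfolded set_integrable_def] ae g_meas
    by (subst integrable_cong_AE[OF _ _ ae]) auto
  have "(LINT t|lborel. g t) = (LINT t:{L..x}|lborel. h t)"
    unfolding set_lebesgue_integral_def
    using h[unfolded set_integrable_def] ae g_meas by (intro integral_cong_AE) auto
  also have "\<dots> = integral {L..x} h" using h by (rule set_borel_integral_eq_integral)
  finally have g_int: "(LINT t|lborel. g t) = integral {L..x} h" .
  have h_int: "h integrable_on {L..x}" using h by (rule set_borel_integral_eq_integral)
  define Df where "Df i t = s ^ i * exp (s * of_real t)" for i and t :: real
  have Df: "(Df i has_vector_derivative Df (Suc i) t) (at t within {L..x})" for i t
  proof -
    have "((\<lambda>z. s ^ i * exp (s * z)) has_field_derivative Df (Suc i) t) (at (of_real t))"
      unfolding Df_def by (auto intro!: derivative_eq_intros)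
    thus ?thesis unfolding Df_def[of i, abs_def]
      by (intro has_vector_derivative_real_field has_vector_derivative_at_within)
  qed
  \<comment> \<open>Taylor's formula for \<open>t \<mapsto> exp (s * t)\<close> at \<open>L\<close>, with integral remainder\<close>
  have "((\<lambda>t. ((x - t) ^ (Suc k - 1) / fact (Suc k - 1)) *\<^sub>R Df (Suc k) t) has_integral
          Df 0 x - (\<Sum>i<Suc k. ((x - L) ^ i / fact i) *\<^sub>R Df i L)) {L..x}"
    using Df \<open>L \<le> x\<close> by (intro Taylor_has_integral) auto
  from has_integral_mult_right[OF this, of "fact k"]
  have "((\<lambda>t. s ^ Suc k * h t) has_integral
          fact k * (Df 0 x - (\<Sum>i<Suc k. ((x - L) ^ i / fact i) *\<^sub>R Df i L))) {L..x}"
    by (simp add: Df_def h_def scaleR_conv_of_real mult_ac)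
  moreover have "((\<lambda>t. s ^ Suc k * h t) has_integral s ^ Suc k * integral {L..x} h) {L..x}"
    using h_int by (intro has_integral_mult_right integrable_integral)
  ultimately have "s ^ Suc k * integral {L..x} h
      = fact k * (Df 0 x - (\<Sum>i<Suc k. ((x - L) ^ i / fact i) *\<^sub>R Df i L))"
    by (rule has_integral_unique[rotated])
  thus "s ^ Suc k * (LINT t|lborel. g t)
       = fact k * exp (s * of_real x)
         - (\<Sum>i\<le>k. fact k / fact i * s ^ i * exp (s * of_real L) * of_real ((x - L) ^ i))"
    unfolding g_int lessThan_Suc_atMost
    by (simp add: Df_def scaleR_conv_of_real algebra_simps sum_distrib_left)
qed

text \<open>Left of all knots the truncated powers are ordinary powers, which the jumps annihilate.
  This justifies the cutoff at \<open>T 1\<close>.\<close>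

lemma spline_eq_0_left:
  assumes T: "strict_mono_on {1..N + Suc k} T" and t: "t < T 1"
  shows "spline N (Suc k) c T t = 0"
proof -
  have "T i - t > 0" if "i \<in> {1..N + Suc k}" for i
    using strict_mono_onD[OF T, of 1 i] that t by (cases "i = 1") auto
  hence "spline N (Suc k) c T t
      = (\<Sum>i=1..N + Suc k. jump N (Suc k) c T i * of_real ((T i - t) ^ k))"
    unfolding spline_trunc_power[OF T] by (intro sum.cong refl) (auto simp: trunc_power_def)
  thus ?thesis using sum_jump_power[of T N "Suc k" k c t] T by (auto simp: strict_mono_on_imp_inj_on)
qed

text \<open>After the cutoff at \<open>T 1\<close> the boundary terms are grouped by powers of
  \<open>T j - T 1\<close>; the exponents are at most \<open>k\<close>, so each group vanishes by
  \<open>sum_jump_power\<close>.\<close>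

lemma fourier_transform_spline:
  assumes T: "strict_mono_on {1..N + Suc k} T"
  shows "(- \<i> * of_real \<omega>) ^ Suc k * fourier_transform (spline N (Suc k) c T) \<omega>
       = fact k * (\<Sum>j=1..N + Suc k. jump N (Suc k) c T j * exp (- \<i> * of_real (\<omega> * T j)))"
proof -
  let ?a = "jump N (Suc k) c T" and ?I = "{1..N + Suc k}" and ?s = "- \<i> * of_real \<omega>"
  define g where "g x t = complex_of_real (indicator {T 1..} t * trunc_power k (x - t))
                            * exp (?s * of_real t)" for x t
  have T1: "T 1 \<le> T j" if "j \<in> ?I" for j
    using strict_mono_onD[OF T, of 1 j] that by (cases "j = 1") auto
  have g_int: "integrable lborel (g (T j))" if "j \<in> ?I" for j
    unfolding g_def by (rule trunc_power_exp_integral(1)[OF T1[OF that]])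
  have "spline N (Suc k) c T t * exp (- \<i> * of_real (\<omega> * t)) = (\<Sum>j\<in>?I. ?a j * g (T j) t)" for t
  proof (cases "t < T 1")
    case True
    then show ?thesis using spline_eq_0_left[OF T] by (simp add: g_def)
  next
    case False
    then show ?thesis
      unfolding spline_trunc_power[OF T] g_def
      by (simp add: sum_distrib_left mult_ac del: sum.cl_ivl_Suc)
  qed
  hence "fourier_transform (spline N (Suc k) c T) \<omega> = (LINT t|lborel. (\<Sum>j\<in>?I. ?a j * g (T j) t))"
    by (simp add: fourier_transform_def)
  also have "\<dots> = (\<Sum>j\<in>?I. ?a j * (LINT t|lborel. g (T j) t))"
    using g_int by (subst Bochner_Integration.integral_sum) auto
  finally have "?s ^ Suc k * fourier_transform (spline N (Suc k) c T) \<omega>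
      = (\<Sum>j\<in>?I. ?a j * (?s ^ Suc k * (LINT t|lborel. g (T j) t)))"
    by (simp add: sum_distrib_left mult_ac del: sum.cl_ivl_Suc)
  also have "\<dots> = (\<Sum>j\<in>?I. ?a j * (fact k * exp (?s * of_real (T j))
      - (\<Sum>i\<le>k. fact k / fact i * ?s ^ i * exp (?s * of_real (T 1)) * of_real ((T j - T 1) ^ i))))"
    unfolding g_def by (intro sum.cong refl) (subst trunc_power_exp_integral(2)[OF T1], auto)
  also have "\<dots> = fact k * (\<Sum>j\<in>?I. ?a j * exp (?s * of_real (T j)))
      - (\<Sum>j\<in>?I. \<Sum>i\<le>k. fact k / fact i * ?s ^ i * exp (?s * of_real (T 1))
           * (?a j * of_real ((T j - T 1) ^ i)))"
    by (simp add: right_diff_distrib sum_subtractf sum_distrib_left mult_ac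
          del: of_real_power sum.cl_ivl_Suc)
  also have "(\<Sum>j\<in>?I. \<Sum>i\<le>k. fact k / fact i * ?s ^ i * exp (?s * of_real (T 1))
           * (?a j * of_real ((T j - T 1) ^ i)))
      = (\<Sum>i\<le>k. fact k / fact i * ?s ^ i * exp (?s * of_real (T 1))
           * (\<Sum>j\<in>?I. ?a j * of_real ((T j - T 1) ^ i)))"
    unfolding sum_distrib_left by (rule sum.swap)
  also have "\<dots> = 0"
    using sum_jump_power[OF strict_mono_on_imp_inj_on[OF T]] by (intro sum.neutral) auto
  finally show ?thesis by (simp add: mult_ac del: sum.cl_ivl_Suc)
qed

section \<open>Trivial ambiguities in terms of knots and jumps\<close>

lemma spline_shift:
  assumes T: "strict_mono_on {1..N + Suc k} T" and S: "strict_mono_on {1..N + Suc k} S"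
    and \<pi>: "bij_betw \<pi> {1..N + Suc k} {1..N + Suc k}"
    and eq: "\<And>j. j \<in> {1..N + Suc k} \<Longrightarrow>
      S j = t0 + T (\<pi> j) \<and> jump N (Suc k) d S j = u * jump N (Suc k) c T (\<pi> j)"
  shows "spline N (Suc k) d S t = u * spline N (Suc k) c T (t - t0)"
proof -
  let ?I = "{1..N + Suc k}"
  have "spline N (Suc k) d S t
      = (\<Sum>j\<in>?I. u * (jump N (Suc k) c T (\<pi> j) * of_real (trunc_power k (T (\<pi> j) - (t - t0)))))"
    unfolding spline_trunc_power[OF S] using eq by (intro sum.cong refl) (auto simp: algebra_simps)
  also have "\<dots> = (\<Sum>j\<in>?I. u * (jump N (Suc k) c T j * of_real (trunc_power k (T j - (t - t0)))))"
    by (rule sum.reindex_bij_betw[OF \<pi>])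
  finally show ?thesis
    by (simp add: spline_trunc_power[OF T] sum_distrib_left mult_ac del: sum.cl_ivl_Suc)
qed

text \<open>Reflection turns the truncated powers around; by \<open>trunc_power_reflect\<close> this
  costs a sign and polynomials whose weighted sum is zero. Knots are excluded because that identity
  fails there for order 1.\<close>

lemma spline_reflect:
  assumes T: "strict_mono_on {1..N + Suc k} T" and S: "strict_mono_on {1..N + Suc k} S"
    and \<pi>: "bij_betw \<pi> {1..N + Suc k} {1..N + Suc k}"
    and eq: "\<And>j. j \<in> {1..N + Suc k} \<Longrightarrow>
      S j = t0 - T (\<pi> j) \<and> jump N (Suc k) d S j = u * cnj (jump N (Suc k) c T (\<pi> j))"
    and t: "t \<notin> S ` {1..N + Suc k}"
  shows "spline N (Suc k) d S t = (- 1) ^ Suc k * u * cnj (spline N (Suc k) c T (t0 - t))"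
proof -
  let ?I = "{1..N + Suc k}" and ?b = "jump N (Suc k) d S"
  have "spline N (Suc k) d S t
      = (\<Sum>j\<in>?I. ?b j * of_real ((S j - t) ^ k)
           + ?b j * of_real ((- 1) ^ Suc k * trunc_power k (t - S j)))"
    unfolding spline_trunc_power[OF S]
  proof (intro sum.cong refl)
    fix j assume "j \<in> ?I"
    hence "S j - t \<noteq> 0" using t by auto
    thus "?b j * of_real (trunc_power k (S j - t))
        = ?b j * of_real ((S j - t) ^ k) + ?b j * of_real ((- 1) ^ Suc k * trunc_power k (t - S j))"
      by (subst trunc_power_reflect) (auto simp: algebra_simps)
  qed
  also have "\<dots> = (\<Sum>j\<in>?I. ?b j * of_real ((- 1) ^ Suc k * trunc_power k (t - S j)))"
    using sum_jump_power[OF strict_mono_on_imp_inj_on[OF S], of k d t]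
    by (simp only: sum.distrib) simp
  also have "\<dots> = (\<Sum>j\<in>?I. (- 1) ^ Suc k * u * (cnj (jump N (Suc k) c T (\<pi> j))
                      * of_real (trunc_power k (T (\<pi> j) - (t0 - t)))))"
  proof (intro sum.cong refl)
    fix j assume j: "j \<in> ?I"
    hence shift: "t - S j = T (\<pi> j) - (t0 - t)" using eq by simp
    show "?b j * of_real ((- 1) ^ Suc k * trunc_power k (t - S j))
        = (- 1) ^ Suc k * u * (cnj (jump N (Suc k) c T (\<pi> j))
            * of_real (trunc_power k (T (\<pi> j) - (t0 - t))))"
      unfolding shift using eq[OF j] by simp
  qed
  also have "\<dots> = (\<Sum>j\<in>?I. (- 1) ^ Suc k * u * (cnj (jump N (Suc k) c T j)
                      * of_real (trunc_power k (T j - (t0 - t)))))"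
    by (rule sum.reindex_bij_betw[OF \<pi>])
  finally show ?thesis
    by (simp add: spline_trunc_power[OF T] sum_distrib_left mult_ac del: sum.cl_ivl_Suc)
qed

lemma spline_phase_retrieval:
  assumes T: "strict_mono_on {1..N + Suc k} T" and S: "strict_mono_on {1..N + Suc k} S"
    and diss: "dissociated {1..N + Suc k} T"
    and nz: "\<And>j. j \<in> {1..N + Suc k} \<Longrightarrow> jump N (Suc k) c T j \<noteq> 0"
    and eq: "\<And>\<omega>. cmod (fourier_transform (spline N (Suc k) d S) \<omega>)
                = cmod (fourier_transform (spline N (Suc k) c T) \<omega>)"
  shows "trivially_equivalent (spline N (Suc k) c T) (spline N (Suc k) d S)"
proof -
  let ?I = "{1..N + Suc k}" and ?a = "jump N (Suc k) c T" and ?b = "jump N (Suc k) d S"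
  \<comment> \<open>Both transforms carry the same power of \<omega>, which therefore never has to
    be divided out, not even at zero.\<close>
  have "cmod (\<Sum>j\<in>?I. ?a j * exp (- \<i> * of_real (\<omega> * T j)))
      = cmod (\<Sum>j\<in>?I. ?b j * exp (- \<i> * of_real (\<omega> * S j)))" for \<omega>
    using arg_cong[OF fourier_transform_spline[OF T, of \<omega> c], of cmod]
      arg_cong[OF fourier_transform_spline[OF S, of \<omega> d], of cmod] eq[of \<omega>]
    unfolding norm_mult by simp
  moreover have "(\<Sum>j\<in>?I. ?a j) = 0" "(\<Sum>j\<in>?I. ?b j) = 0"
    using sum_jump_power[OF strict_mono_on_imp_inj_on[OF T], of 0 c 0]
      sum_jump_power[OF strict_mono_on_imp_inj_on[OF S], of 0 d 0] by simp_all
  ultimately obtain \<pi> t0 u where \<pi>: "bij_betw \<pi> ?I ?I" and u: "cmod u = 1"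
    and alt: "(\<forall>j\<in>?I. S j = t0 + T (\<pi> j) \<and> ?b j = u * ?a (\<pi> j)) \<or>
              (\<forall>j\<in>?I. S j = t0 - T (\<pi> j) \<and> ?b j = u * cnj (?a (\<pi> j)))"
    using exp_sum_phase_retrieval[of ?I ?a ?b T S] nz diss strict_mono_on_imp_inj_on[OF S]
    by auto
  have phase: "\<exists>\<alpha>. exp (\<i> * of_real \<alpha>) = v" if "cmod v = 1" for v
    using that complex_norm_eq_1_exp by blast
  from alt show ?thesis
  proof
    assume *: "\<forall>j\<in>?I. S j = t0 + T (\<pi> j) \<and> ?b j = u * ?a (\<pi> j)"
    obtain \<alpha> where "exp (\<i> * of_real \<alpha>) = u" using phase u by blast
    with spline_shift[OF T S \<pi>, of t0 d u c] *
    have "AE t in lborel. spline N (Suc k) d S t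
            = exp (\<i> * of_real \<alpha>) * spline N (Suc k) c T (t - t0)"
      by simp
    thus ?thesis unfolding trivially_equivalent_def by blast
  next
    assume *: "\<forall>j\<in>?I. S j = t0 - T (\<pi> j) \<and> ?b j = u * cnj (?a (\<pi> j))"
    \<comment> \<open>The sign produced by the reflection is absorbed into the rotation.\<close>
    have "cmod ((- 1) ^ Suc k * u) = 1" using u by (simp add: norm_mult norm_power)
    then obtain \<alpha> where \<alpha>: "exp (\<i> * of_real \<alpha>) = (- 1) ^ Suc k * u" using phase by blast
    have "AE t in lborel. t \<notin> S ` ?I"
      by (intro AE_not_in countable_imp_null_set_lborel) simp
    hence "AE t in lborel. spline N (Suc k) d S t
             = exp (\<i> * of_real \<alpha>) * cnj (spline N (Suc k) c T (t0 - t))"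
      by eventually_elim (use spline_reflect[OF T S \<pi>, of t0 d u c] * \<alpha> in auto)
    thus ?thesis unfolding trivially_equivalent_def by blast
  qed
qed

subsection \<open>Generic parameters\<close>

text \<open>By Fubini: once the other coordinates are fixed, the form vanishes for at most one value
  of coordinate \<open>i\<close>. The type covers real knots and complex coefficients alike.\<close>

lemma AE_PiM_linear_form_nonzero:
  fixes v :: "'i \<Rightarrow> 'a::{euclidean_space, real_normed_field}"
  assumes "finite I" "i \<in> I" "v i \<noteq> 0"
  shows "AE x in Pi\<^sub>M I (\<lambda>_. lborel). (\<Sum>j\<in>I. v j * x j) \<noteq> 0"
proof -
  interpret product_sigma_finite "\<lambda>_::'i. lborel :: 'a measure" ..
  let ?J = "I - {i}" and ?M = "Pi\<^sub>M I (\<lambda>_. lborel) :: ('i \<Rightarrow> 'a) measure"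
  have I: "insert i ?J = I" using assms by auto
  let ?Z = "{x \<in> space ?M. (\<Sum>j\<in>I. v j * x j) = 0}"
  have Z[measurable]: "?Z \<in> sets ?M"
    by measurable
  have "emeasure ?M ?Z = (\<integral>\<^sup>+ x. indicator ?Z x \<partial>?M)" by simp
  also have "\<dots> = (\<integral>\<^sup>+ x. \<integral>\<^sup>+ y. indicator ?Z (x(i := y)) \<partial>lborel \<partial>Pi\<^sub>M ?J (\<lambda>_. lborel))"
    using product_nn_integral_insert[of ?J i "indicator ?Z"] assms(1) I by simp
  also have "\<dots> = (\<integral>\<^sup>+ x. 0 \<partial>(Pi\<^sub>M ?J (\<lambda>_. lborel) :: ('i \<Rightarrow> 'a) measure))"
  proof (intro nn_integral_cong)
    fix x :: "'i \<Rightarrow> 'a"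
    define r where "r = - (\<Sum>j\<in>?J. v j * x j) / v i"
    have "(\<Sum>j\<in>I. v j * (x(i := y)) j) = v i * y + (\<Sum>j\<in>?J. v j * x j)" for y
      using assms by (subst sum.remove[of I i]) (auto intro!: sum.cong)
    hence "indicator ?Z (x(i := y)) \<le> (indicator {r} y :: ennreal)" for y
      using assms(3) by (auto simp: indicator_def r_def field_simps add_eq_0_iff)
    hence "(\<integral>\<^sup>+ y. indicator ?Z (x(i := y)) \<partial>lborel) \<le> (\<integral>\<^sup>+ y. indicator {r} y \<partial>lborel)"
      by (intro nn_integral_mono)
    thus "(\<integral>\<^sup>+ y. indicator ?Z (x(i := y)) \<partial>lborel) = 0" by simp
  qed
  finally have "emeasure ?M ?Z = 0" by simp
  thus ?thesis using Z by (intro AE_I[of _ _ ?Z]) auto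
qed

text \<open>There are countably many pairs of finite multisets over \<open>I\<close>, and each pair
  of distinct ones excludes only the zero set of a nonzero integer linear form.\<close>

lemma AE_PiM_dissociated:
  assumes "finite I"
  shows "AE x in Pi\<^sub>M I (\<lambda>_. lborel :: real measure). dissociated I x"
proof -
  have count: "countable {A. set_mset A \<subseteq> I}"
  proof -
    have "{A. set_mset A \<subseteq> I} \<subseteq> mset ` lists I"
    proof
      fix A assume A: "A \<in> {A. set_mset A \<subseteq> I}"
      obtain xs where "mset xs = A" using ex_mset by blast
      with A show "A \<in> mset ` lists I"
        by (intro image_eqI[of _ _ xs]) (auto simp: in_lists_conv_set)
    qed
    moreover have "countable (mset ` lists I)"
      using assms by (intro countable_image countable_lists) (rule countable_finite)
    ultimately show ?thesis by (rule countable_subset)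
  qed
  have *: "AE x in Pi\<^sub>M I (\<lambda>_. lborel :: real measure). (\<Sum>i\<in>#A. x i) = (\<Sum>i\<in>#B. x i) \<longrightarrow> A = B"
    if AB: "set_mset A \<subseteq> I" "set_mset B \<subseteq> I" for A B
  proof (cases "A = B")
    case False
    then obtain i where i: "count A i \<noteq> count B i" by (auto simp: multiset_eq_iff)
    hence "i \<in># A \<or> i \<in># B" by (metis not_in_iff)
    hence iI: "i \<in> I" using AB by auto
    have eq: "(\<Sum>i\<in>#C. x i) = (\<Sum>i\<in>I. real (count C i) * x i)" if "set_mset C \<subseteq> I"
      for C and x :: "'a \<Rightarrow> real"
      using that
    proof (induction C)
      case (add a C)
      have "(\<Sum>i\<in>I. real (count (add_mset a C) i) * x i)
          = (\<Sum>i\<in>I. (if i = a then x i else 0) + real (count C i) * x i)"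
        by (intro sum.cong refl) (auto simp: algebra_simps)
      thus ?case using add assms by (simp add: sum.distrib)
    qed simp
    have "AE x in Pi\<^sub>M I (\<lambda>_. lborel). (\<Sum>j\<in>I. (real (count A j) - real (count B j)) * x j) \<noteq> 0"
      using i iI assms by (intro AE_PiM_linear_form_nonzero) auto
    thus ?thesis
      by eventually_elim (auto simp: eq AB left_diff_distrib sum_subtractf)
  qed simp
  have "AE x in Pi\<^sub>M I (\<lambda>_. lborel :: real measure). \<forall>A\<in>{A. set_mset A \<subseteq> I}. \<forall>B\<in>{A. set_mset A \<subseteq> I}.
      (\<Sum>i\<in>#A. x i) = (\<Sum>i\<in>#B. x i) \<longrightarrow> A = B"
    unfolding AE_ball_countable[OF count] using * by blast
  thus ?thesis by eventually_elim (auto simp: dissociated_def)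
qed

text \<open>Supplies the measurability of the exceptional set that Fubini requires.\<close>

lemma measurable_jump:
  assumes "i \<in> {1..N + m}"
  shows "(\<lambda>(c, T). jump N m c T i) \<in> borel_measurable (spline_params N m)"
proof -
  have T: "(\<lambda>p. snd p l) \<in> borel_measurable (spline_params N m)" if "l \<in> {1..N + m}" for l
    using that unfolding spline_params_def by measurable
  have [measurable]: "(\<lambda>p. fst p l) \<in> borel_measurable (spline_params N m)" if "l \<in> {1..N}" for l
    using that unfolding spline_params_def by measurable
  have [measurable]: "(\<lambda>p. jump_weight m (snd p) l i) \<in> borel_measurable (spline_params N m)"
    if "l \<in> {1..N}" for l
  proof (cases "i \<in> {l..l + m}")
    case True
    show ?thesis
      unfolding jump_weight_def lagrange_weight_def if_P[OF True]
      by (intro borel_measurable_times borel_measurable_diff borel_measurable_inverse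
            borel_measurable_prod T) (use that True in auto)
  next
    case False
    show ?thesis unfolding jump_weight_def if_not_P[OF False] by simp
  qed
  show ?thesis unfolding jump_def split_beta by measurable
qed

text \<open>For almost all knots, which are then distinct, every jump is a nonzero linear form in
  the coefficients. \<open>AE_commute\<close> and \<open>AE_pair_iff\<close> carry this iterated
  statement to the product measure.\<close>

lemma AE_spline_params_jump_nonzero:
  assumes "N \<ge> 1" "m \<ge> 1"
  shows "AE (c, T) in spline_params N m. \<forall>i\<in>{1..N + m}. jump N m c T i \<noteq> 0"
proof -
  let ?C = "Pi\<^sub>M {1..N} (\<lambda>_. lborel) :: (nat \<Rightarrow> complex) measure"
  let ?T = "Pi\<^sub>M {1..N + m} (\<lambda>_. lborel) :: (nat \<Rightarrow> real) measure"
  interpret C: product_sigma_finite "\<lambda>_::nat. lborel :: complex measure" ..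
  interpret T: product_sigma_finite "\<lambda>_::nat. lborel :: real measure" ..
  interpret pair_sigma_finite ?C ?T
    by (intro pair_sigma_finite.intro C.sigma_finite T.sigma_finite) auto
  have meas: "{p \<in> space (?C \<Otimes>\<^sub>M ?T). \<forall>i\<in>{1..N + m}. jump N m (fst p) (snd p) i \<noteq> 0}
                \<in> sets (?C \<Otimes>\<^sub>M ?T)"
    using measurable_jump[of _ N m] unfolding spline_params_def split_beta by measurable
  have "AE T in ?T. AE c in ?C. \<forall>i\<in>{1..N + m}. jump N m c T i \<noteq> 0"
    using AE_PiM_dissociated[OF finite_atLeastAtMost, of 1 "N + m"]
  proof eventually_elim
    case (elim T)
    hence "inj_on T {1..N + m}" by (rule dissociated_imp_inj_on)
    hence "AE c in ?C. jump N m c T i \<noteq> 0" if i: "i \<in> {1..N + m}" for i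
    proof -
      obtain l where "l \<in> {1..N}" "jump_weight m T l i \<noteq> 0"
        using jump_weight_nonzero[OF \<open>inj_on T {1..N + m}\<close> assms i] by blast
      thus ?thesis unfolding jump_def by (intro AE_PiM_linear_form_nonzero) auto
    qed
    thus ?case by (subst AE_ball_countable) auto
  qed
  hence "AE p in ?C \<Otimes>\<^sub>M ?T. \<forall>i\<in>{1..N + m}. jump N m (fst p) (snd p) i \<noteq> 0"
    using AE_commute[OF meas] AE_pair_iff[OF meas] by blast
  thus ?thesis unfolding spline_params_def case_prod_beta' .
qed

text \<open>The cylinder over a null set of knots is null. Working with a null superset
  \<open>Z\<close> avoids measurability of \<open>dissociated\<close> itself.\<close>

lemma AE_spline_params_dissociated:
  "AE (c, T) in spline_params N m. dissociated {1..N + m} T"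
proof -
  interpret T: product_sigma_finite "\<lambda>_::nat. lborel :: real measure" ..
  let ?C = "Pi\<^sub>M {1..N} (\<lambda>_. lborel) :: (nat \<Rightarrow> complex) measure"
  let ?T = "Pi\<^sub>M {1..N + m} (\<lambda>_. lborel) :: (nat \<Rightarrow> real) measure"
  interpret sigma_finite_measure ?T by (intro T.sigma_finite) auto
  from AE_PiM_dissociated[OF finite_atLeastAtMost, of 1 "N + m"] obtain Z where
    Z: "Z \<in> null_sets ?T" "{T \<in> space ?T. \<not> dissociated {1..N + m} T} \<subseteq> Z"
    by (auto simp: eventually_ae_filter)
  have "emeasure (?C \<Otimes>\<^sub>M ?T) (space ?C \<times> Z) = 0"
    using Z(1) by (subst emeasure_pair_measure_Times) auto
  hence "AE p in ?C \<Otimes>\<^sub>M ?T. dissociated {1..N + m} (snd p)"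
    using Z by (intro AE_I[of _ _ "space ?C \<times> Z"]) (auto simp: space_pair_measure)
  thus ?thesis unfolding spline_params_def case_prod_beta' .
qed

theorem corollary4p2:
  fixes N m :: nat
  assumes "N \<ge> 1" and "m \<ge> 1"
  shows "AE (c, T) in spline_params N m. strict_mono_on {1..N + m} T \<longrightarrow>
    (\<forall>(d :: nat \<Rightarrow> complex) (S :: nat \<Rightarrow> real). strict_mono_on {1..N + m} S \<longrightarrow>
      (\<forall>\<omega>::real. cmod (fourier_transform (spline N m d S) \<omega>)
              = cmod (fourier_transform (spline N m c T) \<omega>)) \<longrightarrow>
      trivially_equivalent (spline N m c T) (spline N m d S))"
proof -
  obtain k where m: "m = Suc k" using assms(2) by (cases m) auto
  show ?thesis
    using AE_spline_params_jump_nonzero[OF assms] AE_spline_params_dissociated[of N m]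
    unfolding m
  proof eventually_elim
    case (elim p)
    obtain c T where p: "p = (c, T)" by (cases p)
    show ?case
      unfolding p prod.case
    proof (intro impI allI)
      fix d S
      assume "strict_mono_on {1..N + Suc k} T" "strict_mono_on {1..N + Suc k} S"
        "\<forall>\<omega>. cmod (fourier_transform (spline N (Suc k) d S) \<omega>)
            = cmod (fourier_transform (spline N (Suc k) c T) \<omega>)"
      with elim show "trivially_equivalent (spline N (Suc k) c T) (spline N (Suc k) d S)"
        unfolding p prod.case by (intro spline_phase_retrieval) simp_all
    qed
  qed
qed

end
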